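(* Consider the polynomial system $s_{t+1}=P(s_t,a_t)$, $a_t=\Phi(s_t)^\top\theta+\varepsilon_t$ ($0\le t\le T-1$) with polynomial reward $r$, and its REINFORCE estimators $$\widehat G_\theta=R(\tau)\sum_{t=0}^{T-1}\Phi(s_t)\Sigma^{-1}\varepsilon_t,\qquad \widehat G_\ell=R(\tau)\sum_{t=0}^{T-1}\big(\Sigma^{-1}(\varepsilon_t\odot\varepsilon_t)-\mathbf 1\big),$$ as described in the context. Let $\xi:=(s_0,\varepsilon_0,\dots,\varepsilon_{T-1})\in\mathbb R^{n+mT}$. (i) (Polynomial estimator) For each $t\le T$ the random vector $s_t$, and for each $t\le T-1$ the random vector $a_t$, is a vector-valued polynomial in $\xi$. Consequently $\widehat G_\theta$ and $\widehat G_\ell$ are (vector-valued) polynomials in $\xi$. (ii) (Exact moments) The quantities $\mathbb E[\widehat G_\theta]$, $\mathbb E[\widehat G_\ell]$, $\mathbb E[\|\widehat G_\theta\|_{\mathrm F}^2]$, $\mathbb E[\|\widehat G_\ell\|_{\mathrm F}^2]$ are exactly computable from $\mathrm{Cov}(\xi)$ via Isserlis' theorem: each of them (componentwise) is a finite linear combination, with coefficients read off from the polynomial expressions in (i), of Gaussian monomial moments $\mathbb E[\xi^\alpha]$, and each such moment is $0$ if $|\alpha|$ is odd and otherwise equals the sum over all pairings of the factors of $\xi^\alpha$ of the products of the corresponding entries of $\mathrm{Cov}(\xi)$.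
   Context: $n,m,d,T\ge1$; $P:\mathbb R^n\times\mathbb R^m\to\mathbb R^n$ and $r:\mathbb R^n\times\mathbb R^m\to\mathbb R$ are polynomial maps; $\Phi(s)\in\mathbb R^{d\times m}$ is a matrix of polynomials in $s$; $\theta\in\mathbb R^d$; $\Sigma=\mathrm{diag}(e^{2\ell_1},\dots,e^{2\ell_m})\succ0$ with $\ell\in\mathbb R^m$; $\Sigma_0\succeq0$. $s_0\sim\mathcal N(0,\Sigma_0)$ and $\varepsilon_0,\dots,\varepsilon_{T-1}\sim\mathcal N(0,\Sigma)$ are independent, so $\mathrm{Cov}(\xi)=\mathrm{diag}(\Sigma_0,\Sigma,\dots,\Sigma)$ (block diagonal). The return is $R(\tau)=\sum_{t=0}^{T-1}\gamma^tr(s_{t+1},a_t)$ with discount factor $\gamma$. For a multi-index $\alpha\in\mathbb N^{n+mT}$, $\xi^\alpha=\prod_i\xi_i^{\alpha_i}$ and $|\alpha|=\sum_i\alpha_i$. $\odot$ is the Hadamard product and $\mathbf 1$ the all-ones vector. *)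

theory Defs
  imports
    "HOL-Probability.Probability"
    "HOL-Library.Poly_Mapping"
    "HOL-Library.Disjoint_Sets"
begin

subsection \<open>Real multivariate polynomials\<close>

text \<open>
  A multi-index over the variables \<^typ>\<open>'i\<close> is a finitely supported map to \<^typ>\<open>nat\<close>, a polynomial
  is a finitely supported map from multi-indices to coefficients.  Products of polynomials are the
  convolution product of \<^theory>\<open>HOL-Library.Poly_Mapping\<close>.
\<close>

type_synonym 'i multi_index = "'i \<Rightarrow>\<^sub>0 nat"
type_synonym 'i mpoly = "'i multi_index \<Rightarrow>\<^sub>0 real"

definition monomial_value :: "('i \<Rightarrow> real) \<Rightarrow> 'i multi_index \<Rightarrow> real" where
  "monomial_value x \<alpha> = (\<Prod>i\<in>Poly_Mapping.keys \<alpha>. x i ^ Poly_Mapping.lookup \<alpha> i)"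

definition multi_degree :: "'i multi_index \<Rightarrow> nat" where
  "multi_degree \<alpha> = (\<Sum>i\<in>Poly_Mapping.keys \<alpha>. Poly_Mapping.lookup \<alpha> i)"

definition mpoly_eval :: "('i \<Rightarrow> real) \<Rightarrow> 'i mpoly \<Rightarrow> real" where
  "mpoly_eval x p = (\<Sum>\<alpha>\<in>Poly_Mapping.keys p. Poly_Mapping.lookup p \<alpha> * monomial_value x \<alpha>)"

definition mpoly_vars :: "'i mpoly \<Rightarrow> 'i set" where
  "mpoly_vars p = (\<Union>\<alpha>\<in>Poly_Mapping.keys p. Poly_Mapping.keys \<alpha>)"


subsection \<open>Pairings\<close>

text \<open>The factors of the monomial with exponents \<open>\<alpha>\<close>: variable \<open>i\<close> contributes \<open>\<alpha> i\<close> labelled copies.\<close>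

definition factors :: "'i multi_index \<Rightarrow> ('i \<times> nat) set" where
  "factors \<alpha> = {(i, c). c < Poly_Mapping.lookup \<alpha> i}"

definition pairings :: "'a set \<Rightarrow> 'a set set set" where
  "pairings A = {\<pi>. partition_on A \<pi> \<and> (\<forall>B\<in>\<pi>. card B = 2)}"

text \<open>
  The entry of \<open>C\<close> belonging to an unordered pair of factors.  It is well defined for symmetric \<open>C\<close>;
  see \<open>pair_entry_eq\<close>.
\<close>

definition pair_entry :: "('i \<Rightarrow> 'i \<Rightarrow> real) \<Rightarrow> ('i \<times> nat) set \<Rightarrow> real" where
  "pair_entry C B = the_elem {C (fst p) (fst q) | p q. B = {p, q}}"

lemma pair_entry_eq:
  assumes "\<And>i j. C i j = C j i"
  shows "pair_entry C {p, q} = C (fst p) (fst q)"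
proof -
  have "{C (fst p') (fst q') | p' q'. {p, q} = {p', q'}} = {C (fst p) (fst q)}" (is "?A = _")
  proof
    show "?A \<subseteq> {C (fst p) (fst q)}"
      using assms by (auto simp: doubleton_eq_iff)
    show "{C (fst p) (fst q)} \<subseteq> ?A"
      by blast
  qed
  then show ?thesis
    by (simp add: pair_entry_def)
qed

definition pairing_sum :: "('i \<Rightarrow> 'i \<Rightarrow> real) \<Rightarrow> 'i multi_index \<Rightarrow> real" where
  "pairing_sum C \<alpha> = (\<Sum>\<pi>\<in>pairings (factors \<alpha>). \<Prod>B\<in>\<pi>. pair_entry C B)"


subsection \<open>Gaussian vectors and independence\<close>

definition diag_matrix :: "real^'m \<Rightarrow> real^'m^'m" where
  "diag_matrix v = (\<chi> i j. if i = j then v $ i else 0)"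

definition noise_cov :: "real^'m \<Rightarrow> real^'m^'m" where
  "noise_cov l = diag_matrix (\<chi> j. exp (2 * l $ j))"

definition pos_semidef :: "real^'n^'n \<Rightarrow> bool" where
  "pos_semidef S \<longleftrightarrow> transpose S = S \<and> (\<forall>v. 0 \<le> v \<bullet> (S *v v))"

text \<open>
  The normal law with mean \<open>\<mu>\<close> and a possibly singular covariance matrix \<open>S\<close>: every linear functional
  is univariate normal, a normal law of variance 0 being a point mass.
\<close>

definition gaussian_vector :: "'w measure \<Rightarrow> ('w \<Rightarrow> real^'n) \<Rightarrow> real^'n \<Rightarrow> real^'n^'n \<Rightarrow> bool" where
  "gaussian_vector M X \<mu> S \<longleftrightarrow>
     X \<in> borel_measurable M \<and>
     (\<forall>u. (0 < u \<bullet> (S *v u) \<and>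
            distributed M lborel (\<lambda>\<omega>. u \<bullet> X \<omega>) (normal_density (u \<bullet> \<mu>) (sqrt (u \<bullet> (S *v u))))) \<or>
          (u \<bullet> (S *v u) = 0 \<and> (AE \<omega> in M. u \<bullet> X \<omega> = u \<bullet> \<mu>)))"

definition generated_events :: "'w measure \<Rightarrow> ('w \<Rightarrow> 'b::topological_space) \<Rightarrow> 'w set set" where
  "generated_events M X = {X -` A \<inter> space M | A. A \<in> sets borel}"

text \<open>
  Mutual independence of \<open>s0, \<epsilon> 0, \<dots>, \<epsilon> (T - 1)\<close>.  \<open>indep_vars\<close> does not apply directly because
  \<open>s0\<close> and \<open>\<epsilon> t\<close> have different value types.
\<close>

definition indep_noise ::
    "'w measure \<Rightarrow> nat \<Rightarrow> ('w \<Rightarrow> real^'n) \<Rightarrow> (nat \<Rightarrow> 'w \<Rightarrow> real^'m) \<Rightarrow> bool" where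
  "indep_noise M T s0 \<epsilon> \<longleftrightarrow>
     prob_space.indep_sets M
       (case_option (generated_events M s0) (\<lambda>t. generated_events M (\<epsilon> t)))
       (insert None (Some ` {..<T}))"

definition covariance :: "'w measure \<Rightarrow> ('w \<Rightarrow> real) \<Rightarrow> ('w \<Rightarrow> real) \<Rightarrow> real" where
  "covariance M X Y =
     (\<integral>\<omega>. (X \<omega> - (\<integral>\<omega>'. X \<omega>' \<partial>M)) * (Y \<omega> - (\<integral>\<omega>'. Y \<omega>' \<partial>M)) \<partial>M)"


subsection \<open>The noise vector\<close>

text \<open>
  The coordinates of \<open>\<xi> = (s\<^sub>0, \<epsilon>\<^sub>0, \<dots>, \<epsilon>\<^sub>T\<^sub>-\<^sub>1)\<close> are indexed by \<open>Inl i\<close> (entry \<open>i\<close> of \<open>s\<^sub>0\<close>) and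
  \<open>Inr (t, j)\<close> with \<open>t < T\<close> (entry \<open>j\<close> of \<open>\<epsilon>\<^sub>t\<close>).
\<close>

definition xi_coords :: "nat \<Rightarrow> ('n + nat \<times> 'm) set" where
  "xi_coords T = range Inl \<union> Inr ` ({..<T} \<times> UNIV)"

definition xi :: "real^'n \<Rightarrow> (nat \<Rightarrow> real^'m) \<Rightarrow> 'n + nat \<times> 'm \<Rightarrow> real" where
  "xi s0 e = case_sum (\<lambda>i. s0 $ i) (\<lambda>(t, j). e t $ j)"

definition xi_rv :: "('w \<Rightarrow> real^'n) \<Rightarrow> (nat \<Rightarrow> 'w \<Rightarrow> real^'m) \<Rightarrow> 'w \<Rightarrow> 'n + nat \<times> 'm \<Rightarrow> real" where
  "xi_rv s0 \<epsilon> \<omega> = xi (s0 \<omega>) (\<lambda>t. \<epsilon> t \<omega>)"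

lemma card_xi_coords:
  "card (xi_coords T :: ('n::finite + nat \<times> 'm::finite) set) = CARD('n) + CARD('m) * T"
proof -
  have "card (xi_coords T :: ('n + nat \<times> 'm) set)
      = card (range Inl :: ('n + nat \<times> 'm) set)
        + card (Inr ` ({..<T} \<times> UNIV) :: ('n + nat \<times> 'm) set)"
    unfolding xi_coords_def by (intro card_Un_disjoint) auto
  then show ?thesis
    by (simp add: card_image card_cartesian_product)
qed

fun block_cov :: "real^'n^'n \<Rightarrow> real^'m^'m \<Rightarrow> 'n + nat \<times> 'm \<Rightarrow> 'n + nat \<times> 'm \<Rightarrow> real" where
  "block_cov S0 S (Inl i) (Inl j) = S0 $ i $ j"
| "block_cov S0 S (Inr (t, i)) (Inr (u, j)) = (if t = u then S $ i $ j else 0)"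
| "block_cov S0 S _ _ = 0"

lemma block_cov_sym:
  assumes "pos_semidef S0"
  shows "block_cov S0 (noise_cov l) i j = block_cov S0 (noise_cov l) j i"
proof -
  have tr: "transpose S0 = S0"
    using assms by (simp add: pos_semidef_def)
  have S0: "S0 $ a $ b = S0 $ b $ a" for a b
    by (subst tr[symmetric]) (simp add: transpose_def)
  have S: "noise_cov l $ a $ b = noise_cov l $ b $ a" for a b
    by (simp add: noise_cov_def diag_matrix_def)
  show ?thesis
    by (cases "(S0, noise_cov l, i, j)" rule: block_cov.cases) (simp_all add: S0 S)
qed

definition poly_in_xi ::
    "nat \<Rightarrow> (real^'n \<Rightarrow> (nat \<Rightarrow> real^'m) \<Rightarrow> real^'k) \<Rightarrow> ('k \<Rightarrow> ('n + nat \<times> 'm) mpoly) \<Rightarrow> bool" where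
  "poly_in_xi T f p \<longleftrightarrow>
     (\<forall>k. mpoly_vars (p k) \<subseteq> xi_coords T) \<and>
     (\<forall>s0 e k. f s0 e $ k = mpoly_eval (xi s0 e) (p k))"


subsection \<open>The controlled system and its estimators\<close>

definition policy :: "(real^'n \<Rightarrow> real^'m^'d) \<Rightarrow> real^'d \<Rightarrow> real^'n \<Rightarrow> real^'m \<Rightarrow> real^'m" where
  "policy \<Phi> \<theta> s \<epsilon> = transpose (\<Phi> s) *v \<theta> + \<epsilon>"

primrec state ::
    "((real^'n) \<times> (real^'m) \<Rightarrow> real^'n) \<Rightarrow> (real^'n \<Rightarrow> real^'m^'d) \<Rightarrow> real^'d \<Rightarrow>
     real^'n \<Rightarrow> (nat \<Rightarrow> real^'m) \<Rightarrow> nat \<Rightarrow> real^'n" where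
  "state P \<Phi> \<theta> s0 e 0 = s0"
| "state P \<Phi> \<theta> s0 e (Suc t) =
     P (state P \<Phi> \<theta> s0 e t, policy \<Phi> \<theta> (state P \<Phi> \<theta> s0 e t) (e t))"

definition act ::
    "((real^'n) \<times> (real^'m) \<Rightarrow> real^'n) \<Rightarrow> (real^'n \<Rightarrow> real^'m^'d) \<Rightarrow> real^'d \<Rightarrow>
     real^'n \<Rightarrow> (nat \<Rightarrow> real^'m) \<Rightarrow> nat \<Rightarrow> real^'m" where
  "act P \<Phi> \<theta> s0 e t = policy \<Phi> \<theta> (state P \<Phi> \<theta> s0 e t) (e t)"

definition total_return ::
    "((real^'n) \<times> (real^'m) \<Rightarrow> real^'n) \<Rightarrow> ((real^'n) \<times> (real^'m) \<Rightarrow> real) \<Rightarrow>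
     (real^'n \<Rightarrow> real^'m^'d) \<Rightarrow> real^'d \<Rightarrow> real \<Rightarrow> nat \<Rightarrow>
     real^'n \<Rightarrow> (nat \<Rightarrow> real^'m) \<Rightarrow> real" where
  "total_return P r \<Phi> \<theta> \<gamma> T s0 e =
     (\<Sum>t<T. \<gamma> ^ t * r (state P \<Phi> \<theta> s0 e (Suc t), act P \<Phi> \<theta> s0 e t))"

definition G_theta ::
    "((real^'n) \<times> (real^'m) \<Rightarrow> real^'n) \<Rightarrow> ((real^'n) \<times> (real^'m) \<Rightarrow> real) \<Rightarrow>
     (real^'n \<Rightarrow> real^'m^'d) \<Rightarrow> real^'d \<Rightarrow> real^'m \<Rightarrow> real \<Rightarrow> nat \<Rightarrow>
     real^'n \<Rightarrow> (nat \<Rightarrow> real^'m) \<Rightarrow> real^'d" where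
  "G_theta P r \<Phi> \<theta> l \<gamma> T s0 e =
     total_return P r \<Phi> \<theta> \<gamma> T s0 e *\<^sub>R
       (\<Sum>t<T. \<Phi> (state P \<Phi> \<theta> s0 e t) *v (matrix_inv (noise_cov l) *v e t))"

text \<open>On \<^typ>\<open>real^'m\<close>, \<open>*\<close> is the Hadamard product and \<open>1\<close> is the all-ones vector.\<close>

definition G_l ::
    "((real^'n) \<times> (real^'m) \<Rightarrow> real^'n) \<Rightarrow> ((real^'n) \<times> (real^'m) \<Rightarrow> real) \<Rightarrow>
     (real^'n \<Rightarrow> real^'m^'d) \<Rightarrow> real^'d \<Rightarrow> real^'m \<Rightarrow> real \<Rightarrow> nat \<Rightarrow>
     real^'n \<Rightarrow> (nat \<Rightarrow> real^'m) \<Rightarrow> real^'m" where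
  "G_l P r \<Phi> \<theta> l \<gamma> T s0 e =
     total_return P r \<Phi> \<theta> \<gamma> T s0 e *\<^sub>R
       (\<Sum>t<T. matrix_inv (noise_cov l) *v (e t * e t) - 1)"


subsection \<open>Moments by linear combination of monomial moments\<close>

definition monomial_moment :: "'w measure \<Rightarrow> ('w \<Rightarrow> 'i \<Rightarrow> real) \<Rightarrow> 'i multi_index \<Rightarrow> real" where
  "monomial_moment M X \<alpha> = (\<integral>\<omega>. monomial_value (X \<omega>) \<alpha> \<partial>M)"

definition moment_combination :: "'w measure \<Rightarrow> ('w \<Rightarrow> 'i \<Rightarrow> real) \<Rightarrow> 'i mpoly \<Rightarrow> real" where
  "moment_combination M X p = (\<Sum>\<alpha>\<in>Poly_Mapping.keys p. Poly_Mapping.lookup p \<alpha> * monomial_moment M X \<alpha>)"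

text \<open>
  For a random vector \<open>G\<close> whose \<open>k\<close>-th entry is the polynomial \<open>g k\<close> in \<open>X\<close>: its mean and its mean
  squared norm exist and are the combinations of monomial moments of \<open>X\<close> whose coefficients are those
  of \<open>g k\<close> and of \<open>\<Sum>k. (g k)\<^sup>2\<close>.  Integrability is explicit since the integral is totalised.
\<close>

definition moments_read_off ::
    "'w measure \<Rightarrow> ('w \<Rightarrow> 'i \<Rightarrow> real) \<Rightarrow> ('w \<Rightarrow> real^'k) \<Rightarrow> ('k \<Rightarrow> 'i mpoly) \<Rightarrow> bool" where
  "moments_read_off M X G g \<longleftrightarrow>
     integrable M G \<and>
     (\<forall>k. (\<integral>\<omega>. G \<omega> \<partial>M) $ k = moment_combination M X (g k)) \<and>
     integrable M (\<lambda>\<omega>. (norm (G \<omega>))\<^sup>2) \<and>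
     (\<integral>\<omega>. (norm (G \<omega>))\<^sup>2 \<partial>M) = moment_combination M X (\<Sum>k\<in>UNIV. g k * g k)"

end

theory Submission
  imports Defs
begin

text \<open>
  The polynomial part is closure of polynomial functions under composition, by induction on time.
  For Isserlis' theorem, write \<open>Y S\<close> for the sum of the factors in \<open>S\<close>.  Polarization gives
  \<open>k! \<Prod>X = (\<Sum>S. (- 1) ^ (k - |S|) * Y S ^ k)\<close>, and each \<open>Y S\<close> is a univariate, possibly degenerate,
  centred normal variable, so \<open>E (Y S ^ k) = (k - 1) * Var (Y S) * E (Y S ^ (k - 2))\<close>.  Expanding
  \<open>Var (Y S)\<close> and polarizing backwards yields
  \<open>k * E (\<Prod>X) = (\<Sum>a \<noteq> b. C a b * E (\<Prod>c \<noteq> a, b. X c))\<close>.  The sum over pairings satisfies the same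
  recursion, because it can be expanded along the partner of any of the \<open>k\<close> factors.
\<close>

subsection \<open>Polynomial functions\<close>

text \<open>Monomials with different supports are compared over a common finite index set, where an
  absent variable contributes the factor 1.\<close>

lemma monomial_value_superset:
  assumes "finite A" "Poly_Mapping.keys \<alpha> \<subseteq> A"
  shows "monomial_value x \<alpha> = (\<Prod>i\<in>A. x i ^ Poly_Mapping.lookup \<alpha> i)"
  unfolding monomial_value_def
  by (rule prod.mono_neutral_left) (use assms in \<open>auto simp: in_keys_iff\<close>)

lemma monomial_value_add: "monomial_value x (\<alpha> + \<beta>) = monomial_value x \<alpha> * monomial_value x \<beta>"
proof -
  let ?A = "Poly_Mapping.keys \<alpha> \<union> Poly_Mapping.keys \<beta>"
  show ?thesis
    using keys_add[of \<alpha> \<beta>]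
    by (simp add: monomial_value_superset[of ?A] lookup_add power_add prod.distrib)
qed

lemma mpoly_eval_add: "mpoly_eval x (p + q) = mpoly_eval x p + mpoly_eval x q"
  unfolding mpoly_eval_def
  by (rule setsum_keys_plus_distrib) (auto simp: algebra_simps)

lemma mpoly_eval_0 [simp]: "mpoly_eval x 0 = 0"
  by (simp add: mpoly_eval_def)

lemma mpoly_eval_sum: "mpoly_eval x (sum p A) = (\<Sum>a\<in>A. mpoly_eval x (p a))"
  by (induction A rule: infinite_finite_induct) (auto simp: mpoly_eval_add)

lemma mpoly_eval_single [simp]:
  "mpoly_eval x (Poly_Mapping.single \<alpha> c) = c * monomial_value x \<alpha>"
  by (simp add: mpoly_eval_def)

lemma mpoly_expand: "p = (\<Sum>\<alpha>\<in>Poly_Mapping.keys p. Poly_Mapping.single \<alpha> (Poly_Mapping.lookup p \<alpha>))"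
  by (rule poly_mapping_eqI) (auto simp: lookup_sum lookup_single when_def in_keys_iff)

lemma mpoly_eval_mult: "mpoly_eval x (p * q) = mpoly_eval x p * mpoly_eval x q"
proof -
  \<comment> \<open>Once both factors are split into single terms, convolution just adds exponents,
    and \<open>monomial_value_add\<close> applies term by term.\<close>
  have "p * q = (\<Sum>\<alpha>\<in>Poly_Mapping.keys p. \<Sum>\<beta>\<in>Poly_Mapping.keys q.
      Poly_Mapping.single (\<alpha> + \<beta>) (Poly_Mapping.lookup p \<alpha> * Poly_Mapping.lookup q \<beta>))"
    by (subst mpoly_expand[of p], subst mpoly_expand[of q]) (simp add: sum_product mult_single)
  then show ?thesis
    by (simp add: mpoly_eval_sum monomial_value_add mpoly_eval_def[of x p] mpoly_eval_def[of x q]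
        sum_product mult_ac)
qed

lemma mpoly_vars_add: "mpoly_vars (p + q) \<subseteq> mpoly_vars p \<union> mpoly_vars q"
  unfolding mpoly_vars_def using keys_add[of p q] by blast

lemma mpoly_vars_mult: "mpoly_vars (p * q) \<subseteq> mpoly_vars p \<union> mpoly_vars q"
proof
  fix i assume "i \<in> mpoly_vars (p * q)"
  then obtain \<alpha> \<beta> where "\<alpha> \<in> Poly_Mapping.keys p" "\<beta> \<in> Poly_Mapping.keys q"
      "i \<in> Poly_Mapping.keys (\<alpha> + \<beta>)"
    unfolding mpoly_vars_def using keys_mult[of p q] by blast
  then show "i \<in> mpoly_vars p \<union> mpoly_vars q"
    unfolding mpoly_vars_def using keys_add[of \<alpha> \<beta>] by blast
qed

lemma mpoly_vars_sum: "mpoly_vars (sum p A) \<subseteq> (\<Union>a\<in>A. mpoly_vars (p a))"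
  unfolding mpoly_vars_def using keys_sum[of p A] by blast

section \<open>Closure properties of polynomial functions\<close>

text \<open>The point is kept apart from the valuation \<open>v\<close>: it may then be a pair of an
  initial state and an infinite noise sequence, while \<open>V\<close> limits the coordinates that a
  polynomial may use.\<close>

definition mpoly_fun :: "'i set \<Rightarrow> ('x \<Rightarrow> 'i \<Rightarrow> real) \<Rightarrow> ('x \<Rightarrow> real) \<Rightarrow> bool" where
  "mpoly_fun V v f \<longleftrightarrow> (\<exists>p. mpoly_vars p \<subseteq> V \<and> (\<forall>x. f x = mpoly_eval (v x) p))"

lemma mpoly_fun_const [simp]: "mpoly_fun V v (\<lambda>_. c)"
  unfolding mpoly_fun_def
  by (rule exI[of _ "Poly_Mapping.single 0 c"]) (simp add: mpoly_vars_def monomial_value_def)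

lemma mpoly_fun_var: "i \<in> V \<Longrightarrow> mpoly_fun V v (\<lambda>x. v x i)"
  unfolding mpoly_fun_def
  by (rule exI[of _ "Poly_Mapping.single (Poly_Mapping.single i 1) 1"])
    (simp add: mpoly_vars_def monomial_value_def)

lemma mpoly_fun_add:
  assumes "mpoly_fun V v f" "mpoly_fun V v g"
  shows "mpoly_fun V v (\<lambda>x. f x + g x)"
  using assms unfolding mpoly_fun_def by (metis Un_least mpoly_eval_add mpoly_vars_add order_trans)

lemma mpoly_fun_mult:
  assumes "mpoly_fun V v f" "mpoly_fun V v g"
  shows "mpoly_fun V v (\<lambda>x. f x * g x)"
  using assms unfolding mpoly_fun_def by (metis Un_least mpoly_eval_mult mpoly_vars_mult order_trans)

lemma mpoly_fun_diff:
  assumes "mpoly_fun V v f" "mpoly_fun V v g"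
  shows "mpoly_fun V v (\<lambda>x. f x - g x)"
  using mpoly_fun_add[OF assms(1) mpoly_fun_mult[OF mpoly_fun_const[of V v "-1"] assms(2)]] by simp

lemma mpoly_fun_sum:
  "(\<And>a. a \<in> A \<Longrightarrow> mpoly_fun V v (f a)) \<Longrightarrow> mpoly_fun V v (\<lambda>x. \<Sum>a\<in>A. f a x)"
  by (induction A rule: infinite_finite_induct) (simp_all add: mpoly_fun_add)

text \<open>The passage from inductively generated polynomial functions to explicit coefficients. A
  linear map is a combination of coordinates weighted by its values on the basis; the other
  generators are closure properties.\<close>

lemma mpoly_fun_compose:
  fixes g :: "'x \<Rightarrow> 'a::euclidean_space"
  assumes "real_polynomial_function f" "\<And>b. b \<in> Basis \<Longrightarrow> mpoly_fun V v (\<lambda>x. g x \<bullet> b)"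
  shows "mpoly_fun V v (\<lambda>x. f (g x))"
  using assms(1)
proof (induction f rule: real_polynomial_function.induct)
  case (linear f)
  interpret bounded_linear f by fact
  have "f (g x) = (\<Sum>b\<in>Basis. (g x \<bullet> b) * f b)" for x
    by (subst euclidean_representation[of "g x", symmetric]) (simp add: sum scaleR)
  then show ?case using assms(2) by (simp, intro mpoly_fun_sum mpoly_fun_mult mpoly_fun_const)
qed (intro mpoly_fun_const mpoly_fun_add mpoly_fun_mult; assumption)+

lemma mpoly_fun_compose_vec:
  fixes g :: "'x \<Rightarrow> real^'k"
  assumes "real_polynomial_function f" "\<And>k. mpoly_fun V v (\<lambda>x. g x $ k)"
  shows "mpoly_fun V v (\<lambda>x. f (g x))"
  by (rule mpoly_fun_compose[OF assms(1)]) (use assms(2) in \<open>auto simp: Basis_vec_def inner_axis\<close>)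

lemma mpoly_fun_compose_pair:
  fixes g :: "'x \<Rightarrow> real^'k" and h :: "'x \<Rightarrow> real^'l"
  assumes "real_polynomial_function f"
    "\<And>k. mpoly_fun V v (\<lambda>x. g x $ k)" "\<And>k. mpoly_fun V v (\<lambda>x. h x $ k)"
  shows "mpoly_fun V v (\<lambda>x. f (g x, h x))"
  by (rule mpoly_fun_compose[OF assms(1)])
    (use assms(2,3) in \<open>auto simp: Basis_prod_def Basis_vec_def inner_axis\<close>)

lemma mpoly_fun_matrix_vector:
  fixes A :: "'x \<Rightarrow> real^'k^'l"
  assumes "\<And>i j. mpoly_fun V v (\<lambda>x. A x $ i $ j)" "\<And>j. mpoly_fun V v (\<lambda>x. y x $ j)"
  shows "mpoly_fun V v (\<lambda>x. (A x *v y x) $ i)"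
  unfolding matrix_vector_mult_def vec_lambda_beta
  by (intro mpoly_fun_sum mpoly_fun_mult assms)

subsection \<open>Polynomial trajectories\<close>

abbreviation xi_fun :: "nat \<Rightarrow> ((real^'n) \<times> (nat \<Rightarrow> real^'m) \<Rightarrow> real) \<Rightarrow> bool" where
  "xi_fun T \<equiv> mpoly_fun (xi_coords T) (\<lambda>(s, e). xi s e)"

lemma xi_fun_init: "xi_fun T (\<lambda>(s, e). s $ i)"
  using mpoly_fun_var[of "Inl i" "xi_coords T" "\<lambda>(s, e). xi s e"]
  by (simp add: xi_coords_def xi_def case_prod_unfold)

lemma xi_fun_noise: "t < T \<Longrightarrow> xi_fun T (\<lambda>(s, e). e t $ j)"
  using mpoly_fun_var[of "Inr (t, j)" "xi_coords T" "\<lambda>(s, e). xi s e"]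
  by (simp add: xi_coords_def xi_def case_prod_unfold image_iff)

lemma poly_in_xiI:
  assumes "\<And>k. xi_fun T (\<lambda>(s, e). f s e $ k)"
  shows "\<exists>p. poly_in_xi T f p"
proof -
  have "\<exists>p. \<forall>k. mpoly_vars (p k) \<subseteq> xi_coords T \<and> (\<forall>s e. f s e $ k = mpoly_eval (xi s e) (p k))"
    using assms unfolding mpoly_fun_def by (intro choice) simp
  then show ?thesis unfolding poly_in_xi_def by blast
qed

context
  fixes P :: "(real^'n) \<times> (real^'m) \<Rightarrow> real^'n"
    and r :: "(real^'n) \<times> (real^'m) \<Rightarrow> real"
    and \<Phi> :: "real^'n \<Rightarrow> real^'m^'d"
    and T :: nat
  assumes P: "polynomial_function P"
    and r: "real_polynomial_function r"
    and \<Phi>: "\<And>k j. real_polynomial_function (\<lambda>s. \<Phi> s $ k $ j)"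
begin

text \<open>An arbitrary \<open>f\<close> with polynomial components stands in for the state, so
  that the induction over time can apply this to its own hypothesis.\<close>

lemma xi_fun_policy:
  assumes "\<And>i. xi_fun T (\<lambda>(s, e). f s e $ i)" "t < T"
  shows "xi_fun T (\<lambda>(s, e). policy \<Phi> \<theta> (f s e) (e t) $ j)"
proof -
  have "xi_fun T (\<lambda>z. \<Phi> (case z of (s, e) \<Rightarrow> f s e) $ k $ j)" for k j
    by (rule mpoly_fun_compose_vec[OF \<Phi>]) (use assms in \<open>simp add: case_prod_unfold\<close>)
  then have "xi_fun T (\<lambda>z. (transpose (\<Phi> (case z of (s, e) \<Rightarrow> f s e)) *v \<theta>) $ j)"
    by (intro mpoly_fun_matrix_vector) (auto simp: transpose_def)
  from mpoly_fun_add[OF this xi_fun_noise[OF assms(2), of j]]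
  show ?thesis by (simp add: policy_def case_prod_unfold)
qed

text \<open>The step to \<open>Suc t\<close> reads the noise \<open>e t\<close>, hence asks for
  \<open>t < T\<close>: states are covered up to time \<open>T\<close>, actions only before it. The
  index \<open>i\<close> is generalised because \<open>P\<close> mixes all components.\<close>

lemma xi_fun_state: "t \<le> T \<Longrightarrow> xi_fun T (\<lambda>(s, e). state P \<Phi> \<theta> s e t $ i)"
proof (induction t arbitrary: i)
  case 0
  then show ?case using xi_fun_init by simp
next
  case (Suc t)
  have IH: "xi_fun T (\<lambda>(s, e). state P \<Phi> \<theta> s e t $ i)" for i
    using Suc by simp
  \<comment> \<open>A map is polynomial if its composition with every bounded linear functional is;
    a coordinate projection is such a functional.\<close>
  have "real_polynomial_function (\<lambda>z. P z $ i)"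
    using P unfolding polynomial_function_def
    by (metis (no_types, lifting) bounded_linear_vec_nth comp_def ext)
  from mpoly_fun_compose_pair[OF this, of "xi_coords T" "\<lambda>(s, e). xi s e"
      "\<lambda>(s, e). state P \<Phi> \<theta> s e t" "\<lambda>(s, e). policy \<Phi> \<theta> (state P \<Phi> \<theta> s e t) (e t)"]
    IH xi_fun_policy[OF IH, of t \<theta>] Suc.prems
  show ?case by (simp add: case_prod_unfold)
qed

lemma xi_fun_act: "t < T \<Longrightarrow> xi_fun T (\<lambda>(s, e). act P \<Phi> \<theta> s e t $ j)"
  unfolding act_def by (intro xi_fun_policy xi_fun_state) auto

lemma xi_fun_return: "xi_fun T (\<lambda>(s, e). total_return P r \<Phi> \<theta> \<gamma> T s e)"
proof -
  have "xi_fun T (\<lambda>z. r ((\<lambda>(s, e). state P \<Phi> \<theta> s e (Suc t)) z, (\<lambda>(s, e). act P \<Phi> \<theta> s e t) z))"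
    if "t < T" for t
    \<comment> \<open>The reward at time \<open>t\<close> reads the state at \<open>Suc t\<close>,
      so the last summand reaches the state at time \<open>T\<close>.\<close>
    using xi_fun_state[of "Suc t" \<theta>] xi_fun_act[OF that, of \<theta>] that
    by (intro mpoly_fun_compose_pair r) (simp_all add: case_prod_unfold del: state.simps)
  then show ?thesis
    unfolding total_return_def case_prod_unfold by (intro mpoly_fun_sum mpoly_fun_mult) auto
qed

text \<open>The inverse covariance does not depend on the noise, so it enters as a matrix of
  constants.\<close>

lemma xi_fun_G_theta: "xi_fun T (\<lambda>(s, e). G_theta P r \<Phi> \<theta> l \<gamma> T s e $ k)"
proof -
  have "xi_fun T (\<lambda>z. (\<Phi> ((\<lambda>(s, e). state P \<Phi> \<theta> s e t) z) *v
      (matrix_inv (noise_cov l) *v snd z t)) $ k)" if "t < T" for t k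
    using xi_fun_state[of t \<theta>] xi_fun_noise[OF that] that
    by (intro mpoly_fun_matrix_vector mpoly_fun_compose_vec[OF \<Phi>])
      (auto simp: case_prod_unfold)
  then show ?thesis
    using xi_fun_return[of \<theta> \<gamma>]
    unfolding G_theta_def case_prod_unfold vector_scaleR_component sum_component real_scaleR_def
    by (intro mpoly_fun_mult mpoly_fun_sum) (auto simp: case_prod_unfold)
qed

lemma xi_fun_G_l: "xi_fun T (\<lambda>(s, e). G_l P r \<Phi> \<theta> l \<gamma> T s e $ j)"
proof -
  have "xi_fun T (\<lambda>z. (matrix_inv (noise_cov l) *v (snd z t * snd z t) - 1) $ j)" if "t < T" for t j
  proof -
    have "xi_fun T (\<lambda>z. snd z t $ i)" for i
      using xi_fun_noise[OF that, of i] by (simp add: case_prod_unfold)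
    then have "xi_fun T (\<lambda>z. (snd z t * snd z t) $ i)" for i
      unfolding vector_mult_component by (intro mpoly_fun_mult)
    then show ?thesis
      unfolding vector_minus_component by (intro mpoly_fun_diff mpoly_fun_matrix_vector) simp_all
  qed
  then show ?thesis
    using xi_fun_return[of \<theta> \<gamma>]
    unfolding G_l_def case_prod_unfold vector_scaleR_component sum_component real_scaleR_def
    by (intro mpoly_fun_mult mpoly_fun_sum) (auto simp: case_prod_unfold)
qed

end

subsection \<open>Polarization\<close>

lemma sum_Pow_insert:
  fixes h :: "'a set \<Rightarrow> real"
  assumes "finite A" "a \<notin> A"
  shows "(\<Sum>S\<in>Pow (insert a A). h S) = (\<Sum>S\<in>Pow A. h (insert a S)) + (\<Sum>S\<in>Pow A. h S)"
proof -
  have "inj_on (insert a) (Pow A)"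
    using assms(2) by (auto simp: inj_on_def)
  moreover have "Pow A \<inter> insert a ` Pow A = {}"
    using assms(2) by auto
  ultimately show ?thesis
    using assms(1) unfolding Pow_insert
    by (subst sum.union_disjoint) (auto simp: sum.reindex o_def)
qed

text \<open>The left side is an iterated finite difference of the \<open>j\<close>-th power at
  \<open>c\<close>, with one step \<open>x a\<close> for each \<open>a\<close> in \<open>A\<close>.
  Each difference lowers the degree by one: for \<open>j < card A\<close> everything cancels, for
  \<open>j = card A\<close> the leading term remains. The shift \<open>c\<close> serves
  \<open>polarization_superset\<close>.\<close>

lemma polarization:
  fixes x :: "'a \<Rightarrow> real"
  assumes "finite A" "j \<le> card A"
  shows "(\<Sum>S\<in>Pow A. (-1) ^ card (A - S) * (c + sum x S) ^ j)
    = (if j = card A then fact j * prod x A else 0)"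
  using assms
proof (induction A arbitrary: j c rule: finite_induct)
  case empty
  then show ?case by simp
next
  case (insert a A)
  let ?s = "\<lambda>S. (-1) ^ card (A - S) :: real"
  have c1: "card (insert a A - insert a S) = card (A - S)"
    and c2: "card (insert a A - S) = Suc (card (A - S))" if "S \<in> Pow A" for S
  proof -
    have "insert a A - insert a S = A - S" "insert a A - S = insert a (A - S)"
      using that insert.hyps by auto
    then show "card (insert a A - insert a S) = card (A - S)"
      "card (insert a A - S) = Suc (card (A - S))"
      using insert.hyps by auto
  qed
  have x: "sum x (insert a S) = x a + sum x S" if "S \<in> Pow A" for S
    using that insert.hyps by (subst sum.insert) (auto intro: finite_subset)
  \<comment> \<open>A single difference cancels the top power. The remaining exponents are below
    \<open>j\<close>, hence at most \<open>card A\<close>, as the induction hypothesis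
    requires.\<close>
  have e: "(c + (x a + y)) ^ j - (c + y) ^ j
      = (\<Sum>i<j. of_nat (j choose i) * x a ^ (j - i) * (c + y) ^ i)" for y :: real
  proof -
    have "(c + (x a + y)) ^ j = ((c + y) + x a) ^ j"
      by (simp add: algebra_simps)
    also have "\<dots> = (\<Sum>i\<le>j. of_nat (j choose i) * (c + y) ^ i * x a ^ (j - i))"
      by (rule binomial_ring)
    also have "\<dots> = (\<Sum>i<j. of_nat (j choose i) * (c + y) ^ i * x a ^ (j - i)) + (c + y) ^ j"
      by (simp add: lessThan_Suc_atMost[symmetric])
    finally show ?thesis by (simp add: mult_ac)
  qed
  \<comment> \<open>Each \<open>S\<close> is matched with \<open>insert a S\<close>, which carries
    the opposite sign.\<close>
  have "(\<Sum>S\<in>Pow (insert a A). (-1) ^ card (insert a A - S) * (c + sum x S) ^ j)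
      = (\<Sum>S\<in>Pow A. ?s S * ((c + (x a + sum x S)) ^ j - (c + sum x S) ^ j))"
    unfolding sum_Pow_insert[OF insert.hyps]
    by (simp only: sum.distrib[symmetric], rule sum.cong[OF refl]) (simp only: c1 c2 x, simp add: algebra_simps)
  also have "\<dots> = (\<Sum>S\<in>Pow A. \<Sum>i<j. of_nat (j choose i) * x a ^ (j - i) * (?s S * (c + sum x S) ^ i))"
    unfolding e by (simp add: sum_distrib_left mult_ac)
  also have "\<dots> = (\<Sum>i<j. of_nat (j choose i) * x a ^ (j - i) * (\<Sum>S\<in>Pow A. ?s S * (c + sum x S) ^ i))"
    unfolding sum_distrib_left by (rule sum.swap)
  also have "\<dots> = (\<Sum>i<j. of_nat (j choose i) * x a ^ (j - i) * (if i = card A then fact i * prod x A else 0))"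
    using insert.prems insert.hyps by (intro sum.cong refl arg_cong2[of _ _ _ _ "(*)"] insert.IH) auto
  also have "\<dots> = (if j = card (insert a A) then fact j * prod x (insert a A) else 0)"
  proof (cases "j = card (insert a A)")
    case True
    then have j: "j = Suc (card A)" using insert.hyps by simp
    \<comment> \<open>Only \<open>i = card A\<close>, that is \<open>j - 1\<close>, survives; its
      binomial coefficient \<open>j\<close> turns \<open>fact (j - 1)\<close> into
      \<open>fact j\<close>.\<close>
    have "(\<Sum>i<j. of_nat (j choose i) * x a ^ (j - i) * (if i = card A then fact i * prod x A else 0))
      = (\<Sum>i\<in>{card A}. of_nat (j choose i) * x a ^ (j - i) * (fact i * prod x A))"
      unfolding j by (rule sum.mono_neutral_cong_right) auto
    then show ?thesis using j insert.hyps by (simp add: mult_ac)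
  next
    case False
    then have "j \<le> card A" using insert.prems insert.hyps by simp
    then have "(\<Sum>i<j. of_nat (j choose i) * x a ^ (j - i) * (if i = card A then fact i * prod x A else 0)) = 0"
      by (intro sum.neutral) auto
    then show ?thesis using False by simp
  qed
  finally show ?case .
qed

lemma sum_Pow_superset:
  fixes h :: "'a set \<Rightarrow> real"
  assumes "finite A" "B \<subseteq> A"
  shows "(\<Sum>S\<in>{S \<in> Pow A. B \<subseteq> S}. h S) = (\<Sum>S\<in>Pow (A - B). h (B \<union> S))"
  by (rule sum.reindex_bij_witness[of _ "\<lambda>S. B \<union> S" "\<lambda>S. S - B"])
     (use assms in \<open>auto simp: Un_absorb1\<close>)

text \<open>Needed for \<open>B = {a, b}\<close>: when the variance of a subset sum is expanded,
  \<open>C a b\<close> occurs exactly for the sets \<open>S\<close> containing both. The fixed part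
  \<open>sum x B\<close> becomes the shift in \<open>polarization\<close>.\<close>

lemma polarization_superset:
  fixes x :: "'a \<Rightarrow> real"
  assumes "finite A" "B \<subseteq> A" "j \<le> card (A - B)"
  shows "(\<Sum>S\<in>{S \<in> Pow A. B \<subseteq> S}. (-1) ^ card (A - S) * (sum x S) ^ j)
    = (if j = card (A - B) then fact j * prod x (A - B) else 0)"
proof -
  have "(\<Sum>S\<in>{S \<in> Pow A. B \<subseteq> S}. (-1) ^ card (A - S) * (sum x S) ^ j)
    = (\<Sum>S\<in>Pow (A - B). (-1) ^ card (A - B - S) * (sum x B + sum x S) ^ j)"
    unfolding sum_Pow_superset[OF assms(1,2)]
  proof (rule sum.cong[OF refl])
    fix S assume S: "S \<in> Pow (A - B)"
    then have "sum x (B \<union> S) = sum x B + sum x S"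
      using assms by (intro sum.union_disjoint) (auto intro: finite_subset)
    moreover have "A - (B \<union> S) = A - B - S" by auto
    ultimately show "(-1) ^ card (A - (B \<union> S)) * (sum x (B \<union> S)) ^ j
      = (-1) ^ card (A - B - S) * (sum x B + sum x S) ^ j" by simp
  qed
  also have "\<dots> = (if j = card (A - B) then fact j * prod x (A - B) else 0)"
    using assms by (intro polarization) auto
  finally show ?thesis .
qed

subsection \<open>Pairings\<close>

lemma pairings_empty [simp]: "pairings {} = {{}}"
  by (auto simp: pairings_def partition_on_def)

lemma finite_pairings: "finite A \<Longrightarrow> finite (pairings A)"
  by (rule finite_subset[of _ "Pow (Pow A)"]) (auto simp: pairings_def partition_on_def)

lemma card_pairing:
  assumes "finite A" "\<pi> \<in> pairings A"
  shows "card A = 2 * card \<pi>"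
proof -
  have p: "partition_on A \<pi>" and c: "\<And>B. B \<in> \<pi> \<Longrightarrow> card B = 2"
    using assms(2) by (auto simp: pairings_def)
  have "card (\<Union>\<pi>) = sum card \<pi>"
    using p c by (intro card_Union_disjoint)
      (auto simp: partition_on_def card_ge_0_finite)
  then show ?thesis using p c by (simp add: partition_on_def)
qed

text \<open>A pairing is determined by the partner \<open>b\<close> of \<open>a\<close> and by what
  is left after deleting the block \<open>{a, b}\<close>.\<close>

lemma pairings_insert:
  assumes "a \<in> A"
  shows "pairings A = (\<Union>b\<in>A - {a}. insert {a, b} ` pairings (A - {a, b}))"
proof (intro equalityI subsetI)
  fix \<pi> assume "\<pi> \<in> pairings A"
  then have p: "partition_on A \<pi>" and c: "\<And>B. B \<in> \<pi> \<Longrightarrow> card B = 2"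
    by (auto simp: pairings_def)
  obtain B where B: "B \<in> \<pi>" "a \<in> B"
    using p assms by (auto simp: partition_on_def)
  obtain b where b: "B = {a, b}" "a \<noteq> b"
    using c[OF B(1)] B(2) by (auto simp: card_2_iff)
  have "partition_on (A - B) (\<pi> - {B})"
  proof (rule partition_onI)
    show "\<Union> (\<pi> - {B}) = A - B"
      using p B(1) by (fastforce simp: partition_on_def disjoint_def)
    show "{} \<notin> \<pi> - {B}"
      using c by fastforce
    show "disjnt p q" if "p \<in> \<pi> - {B}" "q \<in> \<pi> - {B}" "p \<noteq> q" for p q
      using that p by (auto simp: partition_on_def disjoint_def disjnt_def)
  qed
  then have "\<pi> - {B} \<in> pairings (A - {a, b})"
    using c b by (simp add: pairings_def)
  moreover have "\<pi> = insert {a, b} (\<pi> - {B})" using B b by auto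
  moreover have "b \<in> A - {a}" using p B b by (auto simp: partition_on_def)
  ultimately show "\<pi> \<in> (\<Union>b\<in>A - {a}. insert {a, b} ` pairings (A - {a, b}))" by blast
next
  fix \<pi> assume "\<pi> \<in> (\<Union>b\<in>A - {a}. insert {a, b} ` pairings (A - {a, b}))"
  then obtain b \<rho> where b: "b \<in> A" "b \<noteq> a" and \<rho>: "\<rho> \<in> pairings (A - {a, b})"
    and \<pi>: "\<pi> = insert {a, b} \<rho>" by blast
  have "partition_on (insert a (insert b (A - {a, b}))) (insert {a, b} \<rho>)"
    using \<rho> assms b
    by (auto simp: pairings_def partition_on_def disjoint_def)
  moreover have "insert a (insert b (A - {a, b})) = A" using assms b by auto
  ultimately show "\<pi> \<in> pairings A"
    using \<rho> b unfolding \<pi> by (auto simp: pairings_def)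
qed

text \<open>This is the hafnian of \<open>w\<close>. Weights sit on unordered blocks, so no
  orientation of a pair has to be chosen.\<close>

definition pairing_weight :: "('a set \<Rightarrow> real) \<Rightarrow> 'a set \<Rightarrow> real" where
  "pairing_weight w A = (\<Sum>\<pi>\<in>pairings A. prod w \<pi>)"

lemma pairing_weight_empty [simp]: "pairing_weight w {} = 1"
  by (simp add: pairing_weight_def)

lemma pairing_weight_odd: "finite A \<Longrightarrow> odd (card A) \<Longrightarrow> pairing_weight w A = 0"
  unfolding pairing_weight_def by (rule sum.neutral) (auto dest: card_pairing)

text \<open>Hafnian expansion along the row of \<open>a\<close>. The union in
  \<open>pairings_insert\<close> is disjoint since the partner of \<open>a\<close> is unique, and
  inserting the block \<open>{a, b}\<close> is injective since it is never already present.\<close>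

lemma pairing_weight_rec:
  assumes "finite A" "a \<in> A"
  shows "pairing_weight w A = (\<Sum>b\<in>A - {a}. w {a, b} * pairing_weight w (A - {a, b}))"
proof -
  have notin: "{a, b} \<notin> \<rho>" if "\<rho> \<in> pairings (A - {a, b})" for b \<rho>
    using that by (auto simp: pairings_def partition_on_def)
  have fin: "finite \<rho>" if "\<rho> \<in> pairings (A - {a, b})" for b \<rho>
    using that assms(1) by (auto simp: pairings_def intro: finite_elements[rotated])
  have inj: "inj_on (insert {a, b}) (pairings (A - {a, b}))" for b
    by (rule inj_onI) (metis insert_ident notin)
  have disj: "insert {a, b} ` pairings (A - {a, b}) \<inter> insert {a, c} ` pairings (A - {a, c}) = {}"
    if "b \<in> A - {a}" "c \<in> A - {a}" "b \<noteq> c" for b c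
  proof (rule ccontr)
    assume "insert {a, b} ` pairings (A - {a, b}) \<inter> insert {a, c} ` pairings (A - {a, c}) \<noteq> {}"
    then obtain \<rho> \<rho>' where "\<rho> \<in> pairings (A - {a, b})" "\<rho>' \<in> pairings (A - {a, c})"
        "insert {a, b} \<rho> = insert {a, c} \<rho>'" by blast
    \<comment> \<open>As \<open>b\<close> and \<open>c\<close> differ, the block
      \<open>{a, b}\<close> must come from \<open>\<rho>'\<close>, whose blocks avoid
      \<open>a\<close>.\<close>
    then have "{a, b} \<in> \<rho>'" using that by (metis doubleton_eq_iff insertE insertI1)
    then show False using \<open>\<rho>' \<in> pairings (A - {a, c})\<close>
      by (auto simp: pairings_def partition_on_def)
  qed
  have "pairing_weight w A = (\<Sum>b\<in>A - {a}. \<Sum>\<pi>\<in>insert {a, b} ` pairings (A - {a, b}). prod w \<pi>)"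
    unfolding pairing_weight_def pairings_insert[OF assms(2)]
    using assms(1) disj by (intro sum.UNION_disjoint) (auto intro!: finite_imageI finite_pairings)
  also have "\<dots> = (\<Sum>b\<in>A - {a}. \<Sum>\<rho>\<in>pairings (A - {a, b}). w {a, b} * prod w \<rho>)"
  proof (rule sum.cong[OF refl])
    fix b
    show "(\<Sum>\<pi>\<in>insert {a, b} ` pairings (A - {a, b}). prod w \<pi>)
        = (\<Sum>\<rho>\<in>pairings (A - {a, b}). w {a, b} * prod w \<rho>)"
      by (subst sum.reindex[OF inj], unfold o_def, intro sum.cong refl prod.insert fin notin)
  qed
  finally show ?thesis by (simp add: pairing_weight_def sum_distrib_left)
qed

subsection \<open>Isserlis' theorem\<close>

text \<open>Variance 0 is a separate case because \<open>normal_density 0 0\<close> is the zero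
  function, not a probability density.\<close>

definition gaussian_rv :: "'w measure \<Rightarrow> ('w \<Rightarrow> real) \<Rightarrow> real \<Rightarrow> bool" where
  "gaussian_rv M X v \<longleftrightarrow> X \<in> borel_measurable M \<and>
     (0 < v \<and> distributed M lborel X (normal_density 0 (sqrt v)) \<or> v = 0 \<and> (AE \<omega> in M. X \<omega> = 0))"

context prob_space
begin

text \<open>The recursion is Stein's identity for powers. This form also covers variance 0, where
  both sides vanish; for positive variance it follows from the closed moment formulas.\<close>

lemma gaussian_rv_moments:
  assumes "gaussian_rv M X v"
  shows "integrable M (\<lambda>\<omega>. X \<omega> ^ k)"
    and "k \<ge> 2 \<Longrightarrow> expectation (\<lambda>\<omega>. X \<omega> ^ k) = (real k - 1) * v * expectation (\<lambda>\<omega>. X \<omega> ^ (k - 2))"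
    and "expectation X = 0"
proof -
  have "integrable M (\<lambda>\<omega>. X \<omega> ^ k) \<and>
    (k \<ge> 2 \<longrightarrow> expectation (\<lambda>\<omega>. X \<omega> ^ k) = (real k - 1) * v * expectation (\<lambda>\<omega>. X \<omega> ^ (k - 2))) \<and>
    expectation X = 0"
  proof (cases "v = 0")
    case True
    then have X: "X \<in> borel_measurable M" and AE: "AE \<omega> in M. X \<omega> = 0"
      using assms by (auto simp: gaussian_rv_def)
    have "integrable M (\<lambda>\<omega>. X \<omega> ^ k) \<longleftrightarrow> integrable M (\<lambda>\<omega>. 0 ^ k :: real)"
      by (rule integrable_cong_AE) (use X AE in auto)
    moreover have "expectation (\<lambda>\<omega>. X \<omega> ^ k) = expectation (\<lambda>\<omega>. 0 ^ k :: real)" for k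
      by (rule integral_cong_AE) (use X AE in auto)
    moreover have "expectation X = expectation (\<lambda>\<omega>. 0 :: real)"
      by (rule integral_cong_AE) (use X AE in auto)
    ultimately show ?thesis using True by simp
  next
    case False
    then have v: "v > 0" and D: "distributed M lborel X (normal_density 0 (sqrt v))"
      using assms by (auto simp: gaussian_rv_def)
    have s: "sqrt v > 0" using v by simp
    have E: "has_bochner_integral M (\<lambda>\<omega>. X \<omega> ^ (2 * j)) (fact (2 * j) / ((2 / v) ^ j * fact j))"
      for j
      using normal_moment_even[OF s, of 0 j] v
        distributed_integrable[OF D, of "\<lambda>x. x ^ (2 * j)"] distributed_integral[OF D, of "\<lambda>x. x ^ (2 * j)"]
      by (simp add: has_bochner_integral_iff)
    have O: "has_bochner_integral M (\<lambda>\<omega>. X \<omega> ^ (2 * j + 1)) 0" for j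
      using normal_moment_odd[OF s, of 0 j]
        distributed_integrable[OF D, of "\<lambda>x. x ^ (2 * j + 1)"]
        distributed_integral[OF D, of "\<lambda>x. x ^ (2 * j + 1)"]
      by (simp add: has_bochner_integral_iff)
    have 3: "expectation X = 0"
      using O[of 0] by (simp add: has_bochner_integral_iff)
    show ?thesis
    proof (cases "even k")
      case True
      then obtain j where k: "k = 2 * j" by blast
      have "expectation (\<lambda>\<omega>. X \<omega> ^ k) = (real k - 1) * v * expectation (\<lambda>\<omega>. X \<omega> ^ (k - 2))" if k2: "k \<ge> 2"
      proof -
        obtain i where j: "j = Suc i" using k k2 by (cases j) auto
        have "fact (2 * j) = (2 * real j) * (2 * real j - 1) * fact (2 * i)"
          by (simp add: j algebra_simps)
        then have "fact (2 * j) / ((2 / v) ^ j * fact j)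
            = (2 * real j - 1) * v * (fact (2 * i) / ((2 / v) ^ i * fact i))"
        proof -
          \<comment> \<open>With \<open>q\<close> for the denominator of the lower moment, the ratio
            of consecutive even moments becomes a rational identity in \<open>real j\<close> and
            \<open>v\<close>.\<close>
          define q where "q = (2 / v) ^ i * fact i"
          have "q \<noteq> 0" using v by (simp add: q_def)
          have "(2 / v) ^ j * fact j = 2 * real j * q / v"
            by (simp add: j q_def)
          moreover have "2 * r * (2 * r - 1) * F / (2 * r * q / v) = (2 * r - 1) * v * (F / q)"
            if "r > 0" for r F :: real
            using that v \<open>q \<noteq> 0\<close> by simp
          moreover have "real j > 0" by (simp add: j)
          ultimately show ?thesis
            unfolding \<open>fact (2 * j) = _\<close> q_def[symmetric] by (simp only:)
        qed
        moreover have "k - 2 = 2 * i" using k j by simp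
        ultimately show ?thesis using E[of j] E[of i] k by (simp add: has_bochner_integral_iff)
      qed
      then show ?thesis using E[of j] 3 k by (simp add: has_bochner_integral_iff)
    next
      case False
      then obtain j where k: "k = 2 * j + 1" by (elim oddE)
      have "expectation (\<lambda>\<omega>. X \<omega> ^ (k - 2)) = 0" if "k \<ge> 2"
      proof -
        \<comment> \<open>An odd \<open>k\<close> with \<open>k \<ge> 2\<close> is at least 3, so
          \<open>j - 1\<close> is a true predecessor and \<open>k - 2\<close> is odd again.\<close>
        have "k - 2 = 2 * (j - 1) + 1" using k that by auto
        then show ?thesis using O[of "j - 1"] by (simp only: has_bochner_integral_iff)
      qed
      then show ?thesis using O[of j] 3 k by (simp add: has_bochner_integral_iff)
    qed
  qed
  then show "integrable M (\<lambda>\<omega>. X \<omega> ^ k)"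
    and "k \<ge> 2 \<Longrightarrow> expectation (\<lambda>\<omega>. X \<omega> ^ k) = (real k - 1) * v * expectation (\<lambda>\<omega>. X \<omega> ^ (k - 2))"
    and "expectation X = 0" by auto
qed

text \<open>The convolution of normal densities handles two positive variances. If one variance is
  0, the sum agrees almost everywhere with the other summand.\<close>

lemma gaussian_rv_add:
  assumes X: "gaussian_rv M X v" and Y: "gaussian_rv M Y w" and ind: "indep_var borel X borel Y"
  shows "gaussian_rv M (\<lambda>\<omega>. X \<omega> + Y \<omega>) (v + w)"
proof -
  have m[measurable]: "X \<in> borel_measurable M" "Y \<in> borel_measurable M"
    using X Y by (auto simp: gaussian_rv_def)
  \<comment> \<open>Transfer along almost sure equality, for the degenerate cases below.\<close>
  have tr: "gaussian_rv M Z' u" if "gaussian_rv M Z u" "AE \<omega> in M. Z' \<omega> = Z \<omega>"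
    "Z' \<in> borel_measurable M" for Z Z' u
  proof -
    have [measurable]: "Z \<in> borel_measurable M" using that by (simp add: gaussian_rv_def)
    have "distr M lborel Z' = distr M lborel Z"
      by (rule distr_cong_AE) (use that in auto)
    moreover have "AE \<omega> in M. Z' \<omega> = 0" if "AE \<omega> in M. Z \<omega> = 0"
      using that \<open>AE \<omega> in M. Z' \<omega> = Z \<omega>\<close> by eventually_elim auto
    ultimately show ?thesis using that(1,3) unfolding gaussian_rv_def distributed_def by simp blast
  qed
  show ?thesis
  proof (cases "v = 0 \<or> w = 0")
    case True
    then show ?thesis
    proof
      assume "v = 0"
      then have "AE \<omega> in M. X \<omega> + Y \<omega> = Y \<omega>"
        using X by (auto simp: gaussian_rv_def)
      from tr[OF Y this] show ?thesis using \<open>v = 0\<close> by simp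
    next
      assume "w = 0"
      then have "AE \<omega> in M. X \<omega> + Y \<omega> = X \<omega>"
        using Y by (auto simp: gaussian_rv_def)
      from tr[OF X this] show ?thesis using \<open>w = 0\<close> by simp
    qed
  next
    case False
    with X Y have p: "v > 0" "w > 0"
      and D: "distributed M lborel X (normal_density 0 (sqrt v))"
      "distributed M lborel Y (normal_density 0 (sqrt w))"
      by (auto simp: gaussian_rv_def)
    have "distributed M lborel (\<lambda>\<omega>. X \<omega> + Y \<omega>) (normal_density (0 + 0) (sqrt ((sqrt v)\<^sup>2 + (sqrt w)\<^sup>2)))"
      by (rule add_indep_normal[OF ind]) (use p D in auto)
    then show ?thesis using p by (simp add: gaussian_rv_def)
  qed
qed

lemma gaussian_rv_sum:
  assumes "finite I" "indep_vars (\<lambda>_. borel) X I" "\<And>i. i \<in> I \<Longrightarrow> gaussian_rv M (X i) (v i)"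
  shows "gaussian_rv M (\<lambda>\<omega>. \<Sum>i\<in>I. X i \<omega>) (\<Sum>i\<in>I. v i)"
  using assms
proof (induction I rule: finite_induct)
  case empty
  then show ?case by (simp add: gaussian_rv_def)
next
  case (insert i I)
  have "gaussian_rv M (\<lambda>\<omega>. X i \<omega> + (\<Sum>j\<in>I. X j \<omega>)) (v i + (\<Sum>j\<in>I. v j))"
    using insert by (intro gaussian_rv_add indep_vars_sum) (auto intro: indep_vars_subset)
  then show ?case using insert by simp
qed

section \<open>Mixed moments of variables whose subset sums are normal\<close>

context
  fixes A :: "'i set" and X :: "'i \<Rightarrow> 'a \<Rightarrow> real" and C :: "'i \<Rightarrow> 'i \<Rightarrow> real"
  assumes A: "finite A"
    and gauss: "\<And>S. S \<subseteq> A \<Longrightarrow> gaussian_rv M (\<lambda>\<omega>. \<Sum>a\<in>S. X a \<omega>) (\<Sum>a\<in>S. \<Sum>b\<in>S. C a b)"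
begin

text \<open>By polarization the product is a linear combination of powers of subset sums, each
  integrable.\<close>

lemma gaussian_prod_integrable:
  assumes "B \<subseteq> A"
  shows "integrable M (\<lambda>\<omega>. \<Prod>a\<in>B. X a \<omega>)"
proof -
  have fin: "finite B" using A assms by (rule finite_subset[rotated])
  have "integrable M (\<lambda>\<omega>. \<Sum>S\<in>Pow B. (-1) ^ card (B - S) * (\<Sum>a\<in>S. X a \<omega>) ^ card B)"
    using assms by (intro Bochner_Integration.integrable_sum integrable_mult_right
        gaussian_rv_moments(1)[OF gauss]) auto
  moreover have "(\<lambda>\<omega>. \<Sum>S\<in>Pow B. (-1) ^ card (B - S) * (\<Sum>a\<in>S. X a \<omega>) ^ card B)
      = (\<lambda>\<omega>. fact (card B) * (\<Prod>a\<in>B. X a \<omega>))"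
    using polarization[OF fin, of "card B" 0] by simp
  ultimately show ?thesis by simp
qed

text \<open>The diagonal terms \<open>a = b\<close> vanish: there the power \<open>k - 2\<close> is below the number \<open>k - 1\<close> of
  remaining factors.\<close>

lemma gaussian_prod_recursion:
  assumes "B \<subseteq> A" "card B \<ge> 2"
  shows "real (card B) * expectation (\<lambda>\<omega>. \<Prod>a\<in>B. X a \<omega>)
    = (\<Sum>a\<in>B. \<Sum>b\<in>B - {a}. C a b * expectation (\<lambda>\<omega>. \<Prod>c\<in>B - {a, b}. X c \<omega>))"
proof -
  let ?k = "card B"
  let ?Y = "\<lambda>S \<omega>. \<Sum>a\<in>S. X a \<omega>"
  let ?s = "\<lambda>S. (-1) ^ card (B - S) :: real"
  have fin: "finite B" using A assms(1) by (rule finite_subset[rotated])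
  have int: "integrable M (\<lambda>\<omega>. ?Y S \<omega> ^ j)" if "S \<subseteq> B" for S j
    using that assms by (intro gaussian_rv_moments(1)[OF gauss]) auto
  \<comment> \<open>The backward polarization: powers of subset sums are recombined into the product
    of the factors other than \<open>a\<close> and \<open>b\<close>.\<close>
  have inner: "(\<Sum>S\<in>{S \<in> Pow B. {a, b} \<subseteq> S}. ?s S * expectation (\<lambda>\<omega>. ?Y S \<omega> ^ (?k - 2)))
     = (if a = b then 0 else fact (?k - 2) * expectation (\<lambda>\<omega>. \<Prod>c\<in>B - {a, b}. X c \<omega>))"
    if ab: "a \<in> B" "b \<in> B" for a b
  proof -
    have card: "card (B - {a, b}) = (if a = b then ?k - 1 else ?k - 2)"
      using ab fin by (subst card_Diff_subset) auto
    have "(\<Sum>S\<in>{S \<in> Pow B. {a, b} \<subseteq> S}. ?s S * expectation (\<lambda>\<omega>. ?Y S \<omega> ^ (?k - 2)))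
      = expectation (\<lambda>\<omega>. \<Sum>S\<in>{S \<in> Pow B. {a, b} \<subseteq> S}. ?s S * ?Y S \<omega> ^ (?k - 2))"
      using int by (subst Bochner_Integration.integral_sum) auto
    also have "\<dots> = expectation (\<lambda>\<omega>. if ?k - 2 = card (B - {a, b})
        then fact (?k - 2) * (\<Prod>c\<in>B - {a, b}. X c \<omega>) else 0)"
      using ab fin card by (subst polarization_superset) auto
    also have "\<dots> = (if a = b then 0 else fact (?k - 2) * expectation (\<lambda>\<omega>. \<Prod>c\<in>B - {a, b}. X c \<omega>))"
    proof -
      have "card B - 2 \<noteq> card B - 1" using assms(2) by simp
      then show ?thesis using card by simp
    qed
    finally show ?thesis .
  qed
  have "fact ?k * expectation (\<lambda>\<omega>. \<Prod>a\<in>B. X a \<omega>)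
      = expectation (\<lambda>\<omega>. \<Sum>S\<in>Pow B. ?s S * ?Y S \<omega> ^ ?k)"
    using polarization[OF fin, of ?k 0] by simp
  also have "\<dots> = (\<Sum>S\<in>Pow B. ?s S * expectation (\<lambda>\<omega>. ?Y S \<omega> ^ ?k))"
    using int by (subst Bochner_Integration.integral_sum) auto
  also have "\<dots> = (\<Sum>S\<in>Pow B. ?s S * ((real ?k - 1) * (\<Sum>a\<in>S. \<Sum>b\<in>S. C a b) *
      expectation (\<lambda>\<omega>. ?Y S \<omega> ^ (?k - 2))))"
    using assms by (intro sum.cong refl arg_cong2[of _ _ _ _ "(*)"] gaussian_rv_moments(2)[OF gauss]) auto
  also have "\<dots> = (real ?k - 1) * (\<Sum>S\<in>Pow B. \<Sum>a\<in>B. \<Sum>b\<in>B. C a b *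
      (if {a, b} \<subseteq> S then ?s S * expectation (\<lambda>\<omega>. ?Y S \<omega> ^ (?k - 2)) else 0))"
  proof -
    \<comment> \<open>An indicator extends the double sum from \<open>S\<close> to \<open>B\<close>;
      its range no longer depends on \<open>S\<close>, so the sums can be exchanged.\<close>
    have *: "(\<Sum>a\<in>S. \<Sum>b\<in>S. C a b) * z = (\<Sum>a\<in>B. \<Sum>b\<in>B. C a b * (if {a, b} \<subseteq> S then z else 0))"
      if "S \<in> Pow B" for S and z :: real
    proof -
      have "(\<Sum>a\<in>S. \<Sum>b\<in>S. C a b) * z = (\<Sum>(a,b)\<in>S \<times> S. C a b * z)"
        by (simp add: sum.cartesian_product sum_distrib_right case_prod_unfold)
      also have "\<dots> = (\<Sum>(a,b)\<in>B \<times> B. C a b * (if {a, b} \<subseteq> S then z else 0))"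
        by (rule sum.mono_neutral_cong_left) (use that fin in \<open>auto split: if_splits\<close>)
      finally show ?thesis by (simp add: sum.cartesian_product)
    qed
    show ?thesis
      unfolding sum_distrib_left[of "real ?k - 1" _ "Pow B"]
      by (rule sum.cong[OF refl], subst *[symmetric]) (simp_all only: mult_ac)
  qed
  also have "\<dots> = (real ?k - 1) * (\<Sum>a\<in>B. \<Sum>b\<in>B. C a b *
      (\<Sum>S\<in>Pow B. (if {a, b} \<subseteq> S then ?s S * expectation (\<lambda>\<omega>. ?Y S \<omega> ^ (?k - 2)) else 0)))"
    unfolding sum_distrib_left
    by (subst sum.swap, rule sum.cong[OF refl], subst sum.swap) (rule refl)
  also have "\<dots> = (real ?k - 1) * (\<Sum>a\<in>B. \<Sum>b\<in>B. C a b *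
      (if a = b then 0 else fact (?k - 2) * expectation (\<lambda>\<omega>. \<Prod>c\<in>B - {a, b}. X c \<omega>)))"
    using fin by (intro arg_cong2[of _ _ _ _ "(*)"] sum.cong refl, subst inner[symmetric])
       (simp_all add: sum.inter_filter del: Pow_iff mem_Collect_eq insert_subset)
  also have "\<dots> = (real ?k - 1) * fact (?k - 2) *
      (\<Sum>a\<in>B. \<Sum>b\<in>B - {a}. C a b * expectation (\<lambda>\<omega>. \<Prod>c\<in>B - {a, b}. X c \<omega>))"
    unfolding sum_distrib_left
    by (intro sum.cong refl sum.mono_neutral_cong_right) (use fin in auto)
  also have "(real ?k - 1) * fact (?k - 2) = fact (?k - 1)"
    using assms(2) by (metis (no_types, lifting) Suc_1 Suc_diff_le Suc_le_D diff_Suc_1 diff_Suc_Suc fact_Suc of_nat_diff of_nat_1 One_nat_def Suc_leD le_Suc_eq)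
  finally have "fact ?k * expectation (\<lambda>\<omega>. \<Prod>a\<in>B. X a \<omega>) = fact (?k - 1) *
      (\<Sum>a\<in>B. \<Sum>b\<in>B - {a}. C a b * expectation (\<lambda>\<omega>. \<Prod>c\<in>B - {a, b}. X c \<omega>))" .
  \<comment> \<open>Cancelling \<open>fact (?k - 1)\<close> leaves the factor \<open>card B\<close>
    on the left.\<close>
  moreover have "fact ?k = real ?k * fact (?k - 1)"
    using assms(2) by (intro fact_reduce) auto
  ultimately show ?thesis by simp
qed

text \<open>Strong induction on the number of factors. The moment recursion is summed over all
  \<open>a\<close>, while \<open>pairing_weight_rec\<close> fixes one; summing the latter over
  \<open>a\<close> gives \<open>card B\<close> equal terms, and this factor cancels.\<close>

theorem isserlis:
  assumes "B \<subseteq> A" and w: "\<And>a b. w {a, b} = C a b"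
  shows "expectation (\<lambda>\<omega>. \<Prod>a\<in>B. X a \<omega>) = pairing_weight w B"
  using assms(1)
proof (induction "card B" arbitrary: B rule: less_induct)
  case less
  have fin: "finite B" using A less.prems by (rule finite_subset[rotated])
  consider "card B = 0" | "card B = 1" | "card B \<ge> 2" by linarith
  then show ?case
  proof cases
    case 1
    then show ?thesis using fin by (simp add: prob_space)
  next
    case 2
    then obtain a where B: "B = {a}" by (auto simp: card_1_singleton_iff)
    then have "gaussian_rv M (X a) (C a a)" using gauss[of B] less.prems by simp
    then show ?thesis using B gaussian_rv_moments(3) pairing_weight_odd[of B] by simp
  next
    case 3
    have "real (card B) * expectation (\<lambda>\<omega>. \<Prod>a\<in>B. X a \<omega>)
      = (\<Sum>a\<in>B. \<Sum>b\<in>B - {a}. C a b * expectation (\<lambda>\<omega>. \<Prod>c\<in>B - {a, b}. X c \<omega>))"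
      by (rule gaussian_prod_recursion[OF less.prems 3])
    also have "\<dots> = (\<Sum>a\<in>B. \<Sum>b\<in>B - {a}. w {a, b} * pairing_weight w (B - {a, b}))"
      using less.prems fin
      by (intro sum.cong refl arg_cong2[of _ _ _ _ "(*)"] less.hyps psubset_card_mono) (auto simp: w)
    also have "\<dots> = (\<Sum>a\<in>B. pairing_weight w B)"
      by (intro sum.cong refl pairing_weight_rec[symmetric] fin)
    finally show ?thesis using 3 by simp
  qed
qed

end

end

subsection \<open>Gaussian monomial moments\<close>

lemma factors_Sigma: "factors \<alpha> = Sigma (Poly_Mapping.keys \<alpha>) (\<lambda>i. {..<Poly_Mapping.lookup \<alpha> i})"
  by (auto simp: factors_def in_keys_iff)

lemma finite_factors [simp]: "finite (factors \<alpha>)"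
  by (simp add: factors_Sigma)

lemma card_factors: "card (factors \<alpha>) = multi_degree \<alpha>"
  by (simp add: factors_Sigma multi_degree_def)

text \<open>Labelled copies turn powers into products over distinct indices, the form in which
  \<open>isserlis\<close> is stated.\<close>

lemma monomial_value_factors: "monomial_value x \<alpha> = (\<Prod>p\<in>factors \<alpha>. x (fst p))"
  by (simp add: factors_Sigma monomial_value_def prod.Sigma[where g = "\<lambda>i _. x i", simplified case_prod_unfold, symmetric])

section \<open>Jointly normal families and their polynomials\<close>

text \<open>Centred joint normality in Cramer-Wold form, on the coordinates in \<open>I\<close>
  only; \<open>C\<close> may be singular.\<close>

definition gaussian_family :: "'w measure \<Rightarrow> 'i set \<Rightarrow> ('w \<Rightarrow> 'i \<Rightarrow> real) \<Rightarrow> ('i \<Rightarrow> 'i \<Rightarrow> real) \<Rightarrow> bool" where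
  "gaussian_family M I X C \<longleftrightarrow> finite I \<and>
     (\<forall>u. gaussian_rv M (\<lambda>\<omega>. \<Sum>i\<in>I. u i * X \<omega> i) (\<Sum>i\<in>I. \<Sum>j\<in>I. u i * u j * C i j))"

context prob_space
begin

lemma gaussian_family_subset_sum:
  assumes "gaussian_family M I X C" "finite S" "f ` S \<subseteq> I"
  shows "gaussian_rv M (\<lambda>\<omega>. \<Sum>a\<in>S. X \<omega> (f a)) (\<Sum>a\<in>S. \<Sum>b\<in>S. C (f a) (f b))"
proof -
  \<comment> \<open>The map \<open>f\<close> may repeat indices, as copies of one variable do.
    Counting multiplicities turns the sum into a linear functional of the family.\<close>
  define u where "u i = real (card {x \<in> S. f x = i})" for i
  have I: "finite I" using assms(1) by (simp add: gaussian_family_def)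
  have *: "(\<Sum>a\<in>S. h (f a)) = (\<Sum>i\<in>I. u i * h i)" for h :: "_ \<Rightarrow> real"
    unfolding u_def by (rule sum_fun_comp[OF assms(2) I assms(3)])
  have "(\<Sum>a\<in>S. \<Sum>b\<in>S. C (f a) (f b)) = (\<Sum>i\<in>I. \<Sum>j\<in>I. u i * u j * C i j)"
  proof -
    have "(\<Sum>a\<in>S. \<Sum>b\<in>S. C (f a) (f b)) = (\<Sum>a\<in>S. \<Sum>j\<in>I. u j * C (f a) j)"
      by (simp only: *)
    also have "\<dots> = (\<Sum>i\<in>I. u i * (\<Sum>j\<in>I. u j * C i j))"
      by (rule *)
    finally show ?thesis by (simp add: sum_distrib_left mult_ac)
  qed
  moreover have "(\<Sum>a\<in>S. X \<omega> (f a)) = (\<Sum>i\<in>I. u i * X \<omega> i)" for \<omega>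
    by (rule *)
  ultimately show ?thesis
    using assms(1) by (simp add: gaussian_family_def)
qed

lemma gaussian_family_monomials:
  assumes X: "gaussian_family M I X C" and sym: "\<And>i j. C i j = C j i"
    and \<alpha>: "Poly_Mapping.keys \<alpha> \<subseteq> I"
  shows "integrable M (\<lambda>\<omega>. monomial_value (X \<omega>) \<alpha>)"
    and "monomial_moment M X \<alpha> = (if odd (multi_degree \<alpha>) then 0 else pairing_sum C \<alpha>)"
proof -
  have g: "gaussian_rv M (\<lambda>\<omega>. \<Sum>a\<in>S. X \<omega> (fst a)) (\<Sum>a\<in>S. \<Sum>b\<in>S. C (fst a) (fst b))"
    if "S \<subseteq> factors \<alpha>" for S
    using X by (rule gaussian_family_subset_sum)
      (use that \<alpha> finite_subset[OF that] in \<open>auto simp: factors_Sigma\<close>)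
  show "integrable M (\<lambda>\<omega>. monomial_value (X \<omega>) \<alpha>)"
    unfolding monomial_value_factors by (rule gaussian_prod_integrable[OF finite_factors g]) auto
  have "monomial_moment M X \<alpha> = pairing_weight (pair_entry C) (factors \<alpha>)"
    unfolding monomial_moment_def monomial_value_factors
    by (rule isserlis[OF finite_factors g]) (auto intro: pair_entry_eq sym)
  then show "monomial_moment M X \<alpha> = (if odd (multi_degree \<alpha>) then 0 else pairing_sum C \<alpha>)"
    using pairing_weight_odd[of "factors \<alpha>"]
    by (auto simp: card_factors pairing_weight_def pairing_sum_def)
qed

lemma gaussian_family_covariance:
  assumes X: "gaussian_family M I X C" and sym: "\<And>i j. C i j = C j i" and ij: "i \<in> I" "j \<in> I"
  shows "covariance M (\<lambda>\<omega>. X \<omega> i) (\<lambda>\<omega>. X \<omega> j) = C i j"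
proof -
  have "gaussian_rv M (\<lambda>\<omega>. X \<omega> k) (C k k)" if "k \<in> I" for k
    using gaussian_family_subset_sum[OF X, of "{()}" "\<lambda>_. k"] that by simp
  then have 0: "expectation (\<lambda>\<omega>. X \<omega> k) = 0" if "k \<in> I" for k
    using that gaussian_rv_moments(3) by blast
  \<comment> \<open>Indexing by \<open>bool\<close> keeps the two factors distinct even if
    \<open>i = j\<close>, so one argument covers variances and covariances.\<close>
  let ?f = "\<lambda>b. if b then i else j"
  have g: "gaussian_rv M (\<lambda>\<omega>. \<Sum>a\<in>S. X \<omega> (?f a)) (\<Sum>a\<in>S. \<Sum>b\<in>S. C (?f a) (?f b))" for S
    using ij by (intro gaussian_family_subset_sum[OF X]) auto
  \<comment> \<open>For two factors the recursion says that twice the mixed moment is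
    \<open>C i j + C j i\<close>.\<close>
  have "real (card (UNIV :: bool set)) * expectation (\<lambda>\<omega>. \<Prod>a\<in>UNIV. X \<omega> (?f a))
    = (\<Sum>a\<in>UNIV. \<Sum>b\<in>UNIV - {a}. C (?f a) (?f b) * expectation (\<lambda>\<omega>. \<Prod>c\<in>UNIV - {a, b}. X \<omega> (?f c)))"
    by (rule gaussian_prod_recursion[OF _ g]) auto
  then have "2 * expectation (\<lambda>\<omega>. X \<omega> i * X \<omega> j) = C i j + C j i"
    by (simp add: UNIV_bool insert_Diff_if prob_space mult.commute)
  then show ?thesis
    using sym[of i j] by (simp add: covariance_def 0 ij)
qed

text \<open>The squared norm is itself the polynomial with coefficients from the sum of squares of
  the \<open>g k\<close>, so linearity of expectation treats the mean and the second moment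
  alike.\<close>

lemma gaussian_family_read_off:
  fixes G :: "'a \<Rightarrow> real^'k"
  assumes X: "gaussian_family M I X C" and sym: "\<And>i j. C i j = C j i"
    and vars: "\<And>k. mpoly_vars (g k) \<subseteq> I" and G: "\<And>\<omega> k. G \<omega> $ k = mpoly_eval (X \<omega>) (g k)"
  shows "moments_read_off M X G g"
proof -
  have eval: "integrable M (\<lambda>\<omega>. mpoly_eval (X \<omega>) p)"
      "expectation (\<lambda>\<omega>. mpoly_eval (X \<omega>) p) = moment_combination M X p"
    if "mpoly_vars p \<subseteq> I" for p
  proof -
    have int: "integrable M (\<lambda>\<omega>. monomial_value (X \<omega>) \<alpha>)" if "\<alpha> \<in> Poly_Mapping.keys p" for \<alpha>
      using gaussian_family_monomials(1)[OF X sym] that \<open>mpoly_vars p \<subseteq> I\<close>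
      by (force simp: mpoly_vars_def)
    then show "integrable M (\<lambda>\<omega>. mpoly_eval (X \<omega>) p)"
      by (simp add: mpoly_eval_def)
    show "expectation (\<lambda>\<omega>. mpoly_eval (X \<omega>) p) = moment_combination M X p"
      using int by (simp add: mpoly_eval_def moment_combination_def monomial_moment_def)
  qed
  have int: "integrable M (\<lambda>\<omega>. G \<omega> $ k)" for k
    using eval(1)[OF vars] G by simp
  have Gsum: "G \<omega> = (\<Sum>k\<in>UNIV. (G \<omega> $ k) *\<^sub>R axis k 1)" for \<omega>
    by (simp add: vec_eq_iff axis_def if_distrib cong: if_cong)
  have intG: "integrable M G"
    by (subst Gsum[abs_def]) (intro Bochner_Integration.integrable_sum integrable_scaleR_left int)
  have "mpoly_vars (\<Sum>k\<in>UNIV. g k * g k) \<subseteq> I"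
    using mpoly_vars_sum[of "\<lambda>k. g k * g k" UNIV] mpoly_vars_mult vars by fast
  note sq = eval[OF this]
  have norm: "(norm (G \<omega>))\<^sup>2 = mpoly_eval (X \<omega>) (\<Sum>k\<in>UNIV. g k * g k)" for \<omega>
    by (simp add: mpoly_eval_sum mpoly_eval_mult power2_norm_eq_inner inner_vec_def G)
  have "(\<integral>\<omega>. G \<omega> \<partial>M) $ k = moment_combination M X (g k)" for k
    using integral_bounded_linear[OF bounded_linear_vec_nth intG, of k] eval(2)[OF vars] G by simp
  then show ?thesis
    using intG sq by (simp add: moments_read_off_def norm)
qed

lemma gaussian_vector_linear:
  "gaussian_vector M X 0 S \<Longrightarrow> gaussian_rv M (\<lambda>\<omega>. u \<bullet> X \<omega>) (u \<bullet> (S *v u))"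
  by (auto simp: gaussian_vector_def gaussian_rv_def)

text \<open>A linear functional of the noise vector splits into one functional per block. These are
  independent normal variables, so their variances add, matching the vanishing off-diagonal blocks
  of \<open>block_cov\<close>.\<close>

lemma gaussian_family_xi:
  fixes s0 :: "'a \<Rightarrow> real^'n" and \<epsilon> :: "nat \<Rightarrow> 'a \<Rightarrow> real^'m"
  assumes s0: "gaussian_vector M s0 0 S0"
    and \<epsilon>: "\<And>t. t < T \<Longrightarrow> gaussian_vector M (\<epsilon> t) 0 S"
    and ind: "indep_noise M T s0 \<epsilon>"
  shows "gaussian_family M (xi_coords T) (xi_rv s0 \<epsilon>) (block_cov S0 S)"
proof -
  have sum_coords: "(\<Sum>i\<in>xi_coords T. h i) = (\<Sum>i\<in>UNIV. h (Inl i)) + (\<Sum>t<T. \<Sum>j\<in>UNIV. h (Inr (t, j)))"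
    for h :: "'n + nat \<times> 'm \<Rightarrow> real"
    unfolding xi_coords_def
    by (subst sum.union_disjoint) (auto simp: sum.reindex sum.cartesian_product)
  have "gaussian_rv M (\<lambda>\<omega>. \<Sum>i\<in>xi_coords T. u i * xi_rv s0 \<epsilon> \<omega> i)
      (\<Sum>i\<in>xi_coords T. \<Sum>j\<in>xi_coords T. u i * u j * block_cov S0 S i j)" for u
  proof -
    define a :: "real^'n" where "a = (\<chi> i. u (Inl i))"
    define b :: "nat \<Rightarrow> real^'m" where "b t = (\<chi> j. u (Inr (t, j)))" for t
    let ?I = "insert None (Some ` {..<T})"
    \<comment> \<open>The index set is that of \<open>indep_noise\<close>, but every entry is now
      real-valued, so \<open>indep_vars\<close> is applicable.\<close>
    let ?Z = "case_option (\<lambda>\<omega>. a \<bullet> s0 \<omega>) (\<lambda>t \<omega>. b t \<bullet> \<epsilon> t \<omega>)"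
    let ?v = "case_option (a \<bullet> (S0 *v a)) (\<lambda>t. b t \<bullet> (S *v b t))"
    \<comment> \<open>Events of a linear functional are events of the vector, so independence passes
      down to the functionals.\<close>
    have gen: "(\<lambda>\<omega>. c \<bullet> X \<omega>) -` A \<inter> space M \<in> generated_events M X"
      if "A \<in> sets borel" for c :: "'c::euclidean_space" and X :: "'a \<Rightarrow> 'c" and A :: "real set"
    proof -
      from that have "(\<lambda>x. c \<bullet> x) -` A \<in> sets borel"
        using measurable_sets_borel[of "\<lambda>x. c \<bullet> x" borel A] by simp
      moreover have "(\<lambda>\<omega>. c \<bullet> X \<omega>) -` A \<inter> space M = X -` ((\<lambda>x. c \<bullet> x) -` A) \<inter> space M"
        by auto
      ultimately show ?thesis
        unfolding generated_events_def by blast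
    qed
    have gZ: "gaussian_rv M (?Z i) (?v i)" if "i \<in> ?I" for i
      using that gaussian_vector_linear[OF s0] gaussian_vector_linear[OF \<epsilon>] by auto
    have "indep_vars (\<lambda>_. borel) ?Z ?I"
      unfolding indep_vars_def2
    proof (intro conjI ballI)
      fix i assume "i \<in> ?I"
      then show "random_variable borel (?Z i)" using gZ by (simp add: gaussian_rv_def)
    next
      show "indep_sets (\<lambda>i. {?Z i -` A \<inter> space M |A. A \<in> sets borel}) ?I"
        using ind unfolding indep_noise_def
        by (rule indep_sets_mono_sets) (auto intro: gen)
    qed
    then have "gaussian_rv M (\<lambda>\<omega>. \<Sum>i\<in>?I. ?Z i \<omega>) (\<Sum>i\<in>?I. ?v i)"
      by (intro gaussian_rv_sum gZ) auto
    moreover have "(\<Sum>i\<in>?I. ?Z i \<omega>) = (\<Sum>i\<in>xi_coords T. u i * xi_rv s0 \<epsilon> \<omega> i)" for \<omega>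
      by (simp add: sum_coords sum.reindex a_def b_def inner_vec_def xi_rv_def xi_def)
    moreover have "(\<Sum>i\<in>?I. ?v i) = (\<Sum>i\<in>xi_coords T. \<Sum>j\<in>xi_coords T. u i * u j * block_cov S0 S i j)"
    proof -
      have "(\<Sum>t'<T. \<Sum>j\<in>UNIV. u (Inr (t, i)) * u (Inr (t', j)) * (if t = t' then S $ i $ j else 0))
        = (\<Sum>j\<in>UNIV. u (Inr (t, i)) * u (Inr (t, j)) * S $ i $ j)" if "t < T" for t i
        using that by (subst sum.swap) (simp add: if_distrib cong: if_cong)
      then show ?thesis
        by (simp add: sum_coords sum.reindex a_def b_def inner_vec_def matrix_vector_mult_def
            sum_distrib_left mult_ac)
    qed
    ultimately show ?thesis by simp
  qed
  moreover have "finite (xi_coords T :: ('n + nat \<times> 'm) set)"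
    by (simp add: xi_coords_def)
  ultimately show ?thesis by (simp add: gaussian_family_def)
qed

end

text \<open>Existence of the polynomials is separate from the moment formulas, which hold for every
  polynomial representation of the estimators.\<close>

theorem proposition10:
  fixes M :: "'w measure"
    and P :: "(real^'n) \<times> (real^'m) \<Rightarrow> real^'n"
    and r :: "(real^'n) \<times> (real^'m) \<Rightarrow> real"
    and \<Phi> :: "real^'n \<Rightarrow> real^'m^'d"
    and \<theta> :: "real^'d"
    and l :: "real^'m"
    and \<Sigma>0 :: "real^'n^'n"
    and \<gamma> :: real
    and T :: nat
    and s0 :: "'w \<Rightarrow> real^'n"
    and \<epsilon> :: "nat \<Rightarrow> 'w \<Rightarrow> real^'m"
  assumes "T \<ge> 1"
    and "polynomial_function P"
    and "real_polynomial_function r"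
    and "\<And>k j. real_polynomial_function (\<lambda>s. \<Phi> s $ k $ j)"
    and "pos_semidef \<Sigma>0"
    and "prob_space M"
    and "gaussian_vector M s0 0 \<Sigma>0"
    and "\<And>t. t < T \<Longrightarrow> gaussian_vector M (\<epsilon> t) 0 (noise_cov l)"
    and "indep_noise M T s0 \<epsilon>"
  shows
    "(\<forall>t\<le>T. \<exists>p. poly_in_xi T (\<lambda>x e. state P \<Phi> \<theta> x e t) p) \<and>
     (\<forall>t<T. \<exists>p. poly_in_xi T (\<lambda>x e. act P \<Phi> \<theta> x e t) p) \<and>
     (\<exists>g. poly_in_xi T (G_theta P r \<Phi> \<theta> l \<gamma> T) g) \<and>
     (\<exists>h. poly_in_xi T (G_l P r \<Phi> \<theta> l \<gamma> T) h) \<and>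
     (\<forall>g. poly_in_xi T (G_theta P r \<Phi> \<theta> l \<gamma> T) g \<longrightarrow>
        moments_read_off M (xi_rv s0 \<epsilon>) (\<lambda>\<omega>. G_theta P r \<Phi> \<theta> l \<gamma> T (s0 \<omega>) (\<lambda>t. \<epsilon> t \<omega>)) g) \<and>
     (\<forall>h. poly_in_xi T (G_l P r \<Phi> \<theta> l \<gamma> T) h \<longrightarrow>
        moments_read_off M (xi_rv s0 \<epsilon>) (\<lambda>\<omega>. G_l P r \<Phi> \<theta> l \<gamma> T (s0 \<omega>) (\<lambda>t. \<epsilon> t \<omega>)) h) \<and>
     (\<forall>i\<in>xi_coords T. \<forall>j\<in>xi_coords T.
        covariance M (\<lambda>\<omega>. xi_rv s0 \<epsilon> \<omega> i) (\<lambda>\<omega>. xi_rv s0 \<epsilon> \<omega> j) = block_cov \<Sigma>0 (noise_cov l) i j) \<and>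
     (\<forall>\<alpha>. Poly_Mapping.keys \<alpha> \<subseteq> xi_coords T \<longrightarrow>
        integrable M (\<lambda>\<omega>. monomial_value (xi_rv s0 \<epsilon> \<omega>) \<alpha>) \<and>
        monomial_moment M (xi_rv s0 \<epsilon>) \<alpha> =
          (if odd (multi_degree \<alpha>) then 0
           else pairing_sum (block_cov \<Sigma>0 (noise_cov l)) \<alpha>))"
proof -
  interpret prob_space M by fact
  have X: "gaussian_family M (xi_coords T) (xi_rv s0 \<epsilon>) (block_cov \<Sigma>0 (noise_cov l))"
    using assms by (intro gaussian_family_xi)
  note sym = block_cov_sym[OF \<open>pos_semidef \<Sigma>0\<close>, of l]
  note polys = \<open>polynomial_function P\<close> \<open>real_polynomial_function r\<close> assms(4)
  have read_off: "moments_read_off M (xi_rv s0 \<epsilon>) (\<lambda>\<omega>. f (s0 \<omega>) (\<lambda>t. \<epsilon> t \<omega>)) p"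
    if "poly_in_xi T f p" for f :: "real^'n \<Rightarrow> (nat \<Rightarrow> real^'m) \<Rightarrow> real^'k" and p
    using that by (intro gaussian_family_read_off[OF X sym]) (auto simp: poly_in_xi_def xi_rv_def)
  have state: "\<exists>p. poly_in_xi T (\<lambda>x e. state P \<Phi> \<theta> x e t) p" if "t \<le> T" for t
    by (rule poly_in_xiI, rule xi_fun_state[OF polys that])
  have act: "\<exists>p. poly_in_xi T (\<lambda>x e. act P \<Phi> \<theta> x e t) p" if "t < T" for t
    by (rule poly_in_xiI, rule xi_fun_act[OF polys that])
  have G_theta: "\<exists>g. poly_in_xi T (G_theta P r \<Phi> \<theta> l \<gamma> T) g"
    by (rule poly_in_xiI, rule xi_fun_G_theta[OF polys])
  have G_l: "\<exists>h. poly_in_xi T (G_l P r \<Phi> \<theta> l \<gamma> T) h"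
    by (rule poly_in_xiI, rule xi_fun_G_l[OF polys])
  show ?thesis
    by (intro conjI allI ballI impI)
      (rule G_theta G_l | erule state act read_off
        | (rule gaussian_family_covariance[OF X sym]; assumption)
        | erule gaussian_family_monomials[OF X sym])+
qed

end
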